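(* Let $k$ and $v$ be positive integers with $v \equiv 0 \bmod k$. A PDP$(k,v)$ is equivalent to a resolvable $(v,k)$-configuration; that is, a set $\mathcal{B}$ of $k$-subsets (blocks) of a set $V$ of $v$ points is a PDP$(k,v)$ if and only if $(V,\mathcal{B})$ is a resolvable $(v,k)$-configuration.
   Context: A PDP$(k,v)$ (progressive dinner party) is a set $\mathcal{B}$ of blocks of size $k$, defined on a set $V$ of $v$ points, where $v \equiv 0 \bmod k$, such that: (1) the blocks can be partitioned into $k$ parallel classes, each consisting of $v/k$ pairwise disjoint blocks (so there are $v$ blocks in total); (2) no pair of distinct points occurs in more than one block; (3) there is a bijection $h:\mathcal{B}\to V$ such that $h(B)\in B$ for all $B\in\mathcal{B}$. A $(v,k)$-configuration is a pair $(V,\mathcal{B})$, where $V$ is a set of $v$ points and $\mathcal{B}$ is a set of exactly $v$ blocks (subsets of $V$), each containing exactly $k$ points, such that no pair of distinct points occurs in more than one block and every point occurs in exactly $k$ blocks. When $v \equiv 0 \bmod k$, a $(v,k)$-configuration is resolvable if the set of blocks can be partitioned into $k$ parallel classes, each of which consists of $v/k$ blocks that partition the set of points. *)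

theory Defs
  imports Main "HOL-Library.Disjoint_Sets"
begin

definition blocks_of_size :: "nat \<Rightarrow> 'a set \<Rightarrow> 'a set set \<Rightarrow> bool" where
  "blocks_of_size k V \<B> \<longleftrightarrow> (\<forall>B\<in>\<B>. B \<subseteq> V \<and> card B = k)"

definition pairs_at_most_once :: "'a set \<Rightarrow> 'a set set \<Rightarrow> bool" where
  "pairs_at_most_once V \<B> \<longleftrightarrow>
     (\<forall>x\<in>V. \<forall>y\<in>V. x \<noteq> y \<longrightarrow>
        (\<forall>B\<in>\<B>. \<forall>B'\<in>\<B>. {x, y} \<subseteq> B \<and> {x, y} \<subseteq> B' \<longrightarrow> B = B'))"

(* The total number of blocks, v, follows from the sizes of the classes and is
   not a separate clause. *)
definition PDP :: "nat \<Rightarrow> nat \<Rightarrow> 'a set \<Rightarrow> 'a set set \<Rightarrow> bool" where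
  "PDP k v V \<B> \<longleftrightarrow>
     finite V \<and> card V = v \<and> k dvd v \<and>
     blocks_of_size k V \<B> \<and>
     (\<exists>\<P>. partition_on \<B> \<P> \<and> card \<P> = k \<and>
        (\<forall>C\<in>\<P>. card C = v div k \<and> disjoint C)) \<and>
     pairs_at_most_once V \<B> \<and>
     (\<exists>h. bij_betw h \<B> V \<and> (\<forall>B\<in>\<B>. h B \<in> B))"

definition configuration :: "nat \<Rightarrow> nat \<Rightarrow> 'a set \<Rightarrow> 'a set set \<Rightarrow> bool" where
  "configuration v k V \<B> \<longleftrightarrow>
     finite V \<and> card V = v \<and> card \<B> = v \<and>
     blocks_of_size k V \<B> \<and>
     pairs_at_most_once V \<B> \<and>
     (\<forall>x\<in>V. card {B \<in> \<B>. x \<in> B} = k)"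

definition resolvable_configuration :: "nat \<Rightarrow> nat \<Rightarrow> 'a set \<Rightarrow> 'a set set \<Rightarrow> bool" where
  "resolvable_configuration v k V \<B> \<longleftrightarrow>
     k dvd v \<and> configuration v k V \<B> \<and>
     (\<exists>\<P>. partition_on \<B> \<P> \<and> card \<P> = k \<and>
        (\<forall>C\<in>\<P>. card C = v div k \<and> partition_on V C))"

end

theory Submission
  imports Defs
begin

text \<open>
  Both notions ask for \<open>k\<close> classes of \<open>v / k\<close> pairwise disjoint blocks; they differ in that one
  has the bijection \<open>h\<close> and the other has covering classes and constant degree \<open>k\<close>.

  A class of \<open>v / k\<close> pairwise disjoint blocks of size \<open>k\<close> has \<open>v\<close> points in its union, so it
  covers \<open>V\<close> (\<open>disjoint_blocks_partition\<close>).  Hence each point lies in exactly one block of each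
  class and so in exactly \<open>k\<close> blocks altogether (\<open>card_blocks_through_point\<close>), which gives the
  configuration.

  Conversely, the bijection \<open>h\<close> is a perfect matching in the incidence graph of points and blocks.
  In a configuration this bipartite graph is \<open>k\<close>-regular, and counting incidences shows that any
  \<open>m\<close> blocks together contain at least \<open>m\<close> points (\<open>card_le_card_Union_if_degree_le\<close>).  Hall's
  theorem (\<open>hall_distinct_representatives\<close>) then supplies distinct representatives of the blocks;
  as there are as many blocks as points, they exhaust \<open>V\<close>.
\<close>

text \<open>
  The argument of Halmos and Vaughan.  If every nonempty proper subfamily has a point to
  spare, one representative can be chosen freely, since deleting it costs every other subfamily at
  most one point.  Otherwise some proper subfamily \<open>J\<close> has exactly as many points as members; it
  must use all of its points, and the remaining sets still satisfy Hall's condition after these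
  points are deleted, because \<open>J\<close> can be added to any subfamily of them.
\<close>
theorem hall_distinct_representatives:
  fixes A :: "'i \<Rightarrow> 'a set"
  assumes "finite I" and "\<And>i. i \<in> I \<Longrightarrow> finite (A i)"
    and "\<And>J. J \<subseteq> I \<Longrightarrow> card J \<le> card (\<Union>(A ` J))"
  shows "\<exists>h. inj_on h I \<and> (\<forall>i\<in>I. h i \<in> A i)"
  using assms
proof (induction I arbitrary: A rule: finite_psubset_induct)
  case (psubset I)
  note fin = psubset.prems(1) and hall = psubset.prems(2)
  have finU: "finite (\<Union>(A ` J))" if "J \<subseteq> I" for J
    using that fin \<open>finite I\<close> by (meson finite_UN_I finite_subset subsetD)
  show ?case
  proof (cases "I = {}")
    case True
    then show ?thesis by simp
  next
    case False
    show ?thesis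
    proof (cases "\<forall>J. J \<subset> I \<and> J \<noteq> {} \<longrightarrow> card J < card (\<Union>(A ` J))")
      case True
      obtain i where i: "i \<in> I" using \<open>I \<noteq> {}\<close> by blast
      have "A i \<noteq> {}" using hall[of "{i}"] i by auto
      then obtain x where x: "x \<in> A i" by blast
      have "\<exists>h. inj_on h (I - {i}) \<and> (\<forall>j\<in>I - {i}. h j \<in> A j - {x})"
      proof (rule psubset.IH)
        show "I - {i} \<subset> I" using i by blast
        show "finite (A j - {x})" if "j \<in> I - {i}" for j using that fin by blast
        show "card J \<le> card (\<Union>j\<in>J. A j - {x})" if J: "J \<subseteq> I - {i}" for J
        proof (cases "J = {}")
          case True
          then show ?thesis by simp
        next
          case False
          with J i True have "card J < card (\<Union>(A ` J))" by blast
          moreover have "(\<Union>j\<in>J. A j - {x}) = \<Union>(A ` J) - {x}" by blast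
          moreover have "card (\<Union>(A ` J)) - 1 \<le> card (\<Union>(A ` J) - {x})"
            using diff_card_le_card_Diff[of "{x}" "\<Union>(A ` J)"] by simp
          ultimately show ?thesis by simp
        qed
      qed
      then obtain h where h: "inj_on h (I - {i})" "\<forall>j\<in>I - {i}. h j \<in> A j - {x}" by blast
      have "inj_on (h(i := x)) (insert i (I - {i}))"
        using h by (auto simp: inj_on_def)
      moreover have "\<forall>j\<in>I. (h(i := x)) j \<in> A j" using h x by auto
      ultimately show ?thesis using i by (metis insert_Diff)
    next
      case False
      then obtain J where J: "J \<subset> I" "J \<noteq> {}" and "card (\<Union>(A ` J)) \<le> card J"
        by (meson not_less)
      define U where "U = \<Union>(A ` J)"
      have cardU: "card U = card J" and "finite U" and "finite J"
        using \<open>card (\<Union>(A ` J)) \<le> card J\<close> hall[of J] J finU[of J] finite_subset[OF _ \<open>finite I\<close>]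
        by (auto simp: U_def)
      have "\<exists>h. inj_on h J \<and> (\<forall>j\<in>J. h j \<in> A j)"
        using J fin hall by (intro psubset.IH) auto
      then obtain f where f: "inj_on f J" "\<forall>j\<in>J. f j \<in> A j" by blast
      have "\<exists>h. inj_on h (I - J) \<and> (\<forall>j\<in>I - J. h j \<in> A j - U)"
      proof (rule psubset.IH)
        show "I - J \<subset> I" using J by blast
        show "finite (A j - U)" if "j \<in> I - J" for j using that fin by blast
        show "card K \<le> card (\<Union>j\<in>K. A j - U)" if K: "K \<subseteq> I - J" for K
        proof -
          have "finite K" using K \<open>finite I\<close> by (meson Diff_subset finite_subset)
          then have "card K + card J = card (K \<union> J)"
            using K \<open>finite J\<close> by (intro card_Un_disjoint[symmetric]) auto
          also have "\<dots> \<le> card (\<Union>(A ` (K \<union> J)))"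
            using K J by (intro hall) blast
          also have "\<Union>(A ` (K \<union> J)) = (\<Union>j\<in>K. A j - U) \<union> U"
            by (auto simp: U_def)
          also have "card \<dots> \<le> card (\<Union>j\<in>K. A j - U) + card U"
            by (rule card_Un_le)
          finally show ?thesis using cardU by simp
        qed
      qed
      then obtain g where g: "inj_on g (I - J)" "\<forall>j\<in>I - J. g j \<in> A j - U" by blast
      let ?h = "\<lambda>i. if i \<in> J then f i else g i"
      have fU: "f j \<in> U" if "j \<in> J" for j using that f by (auto simp: U_def)
      have gU: "g j \<notin> U" if "j \<in> I" "j \<notin> J" for j using that g by blast
      have "inj_on ?h I"
      proof (rule inj_onI)
        fix a b assume ab: "a \<in> I" "b \<in> I" "?h a = ?h b"
        show "a = b"
        proof (cases "a \<in> J \<longleftrightarrow> b \<in> J")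
          case True
          then show ?thesis
            using ab inj_onD[OF f(1), of a b] inj_onD[OF g(1), of a b] by (cases "a \<in> J") auto
        next
          case False
          then show ?thesis using ab fU gU by metis
        qed
      qed
      moreover have "\<forall>i\<in>I. ?h i \<in> A i" using f g by auto
      ultimately show ?thesis by blast
    qed
  qed
qed

text \<open>
  Counting the incident pairs of a point and a member of \<open>S\<close>, first by members and then by points.
\<close>
lemma card_le_card_Union_if_degree_le:
  fixes S :: "'a set set"
  assumes "finite S" and "0 < k"
    and size: "\<And>B. B \<in> S \<Longrightarrow> finite B \<and> k \<le> card B"
    and degree: "\<And>x. x \<in> \<Union>S \<Longrightarrow> card {B \<in> S. x \<in> B} \<le> k"
  shows "card S \<le> card (\<Union>S)"
proof -
  have finU: "finite (\<Union>S)" using assms by blast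
  have "k * card S \<le> (\<Sum>B\<in>S. card B)"
    using sum_mono[of S "\<lambda>_. k" card] size by (simp add: mult.commute)
  also have "\<dots> = (\<Sum>B\<in>S. card {x \<in> \<Union>S. x \<in> B})"
    by (intro sum.cong arg_cong[where f = card]) auto
  also have "\<dots> = (\<Sum>x\<in>\<Union>S. card {B \<in> S. x \<in> B})"
    using sum.swap_restrict[OF \<open>finite S\<close> finU, of "\<lambda>_ _. 1::nat" "\<lambda>B x. x \<in> B"] by simp
  also have "\<dots> \<le> k * card (\<Union>S)"
    using sum_mono[of "\<Union>S" "\<lambda>x. card {B \<in> S. x \<in> B}" "\<lambda>_. k"] degree
    by (simp add: mult.commute)
  finally show ?thesis using \<open>0 < k\<close> by simp
qed

lemma disjoint_blocks_partition:
  assumes "finite V" and "0 < k" and "k dvd card V"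
    and blocks: "\<And>B. B \<in> C \<Longrightarrow> B \<subseteq> V \<and> card B = k"
    and "disjoint C" and "card C = card V div k"
  shows "partition_on V C"
proof (rule partition_onI)
  have "card (\<Union>C) = (\<Sum>B\<in>C. card B)"
    using \<open>disjoint C\<close> blocks \<open>finite V\<close>
    by (intro card_Union_disjoint) (auto intro: finite_subset)
  also have "\<dots> = card V"
    using blocks assms(3,6) by simp
  finally show "\<Union>C = V"
    using blocks \<open>finite V\<close> by (intro card_subset_eq) auto
  show "disjnt p q" if "p \<in> C" "q \<in> C" "p \<noteq> q" for p q
    using that \<open>disjoint C\<close> by (auto simp: disjnt_def disjoint_def)
  show "{} \<notin> C" using blocks \<open>0 < k\<close> by fastforce
qed

text \<open>
  A point lies in exactly one block of each parallel class, so taking the class of a block is a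
  bijection from the blocks through the point to the classes.
\<close>
lemma card_blocks_through_point:
  assumes part: "partition_on \<B> \<P>" and classes: "\<And>C. C \<in> \<P> \<Longrightarrow> partition_on V C"
    and "x \<in> V"
  shows "card {B \<in> \<B>. x \<in> B} = card \<P>"
proof -
  have uniq: "\<exists>!B. B \<in> C \<and> x \<in> B" if "C \<in> \<P>" for C
  proof -
    have "x \<in> \<Union>C" and "disjoint C"
      using classes[OF that] \<open>x \<in> V\<close> by (auto simp: partition_on_def)
    then show ?thesis unfolding disjoint_def by blast
  qed
  define b where "b C = (THE B. B \<in> C \<and> x \<in> B)" for C
  have b: "b C \<in> C" "x \<in> b C" if "C \<in> \<P>" for C
    using theI'[OF uniq[OF that]] by (auto simp: b_def)
  have "bij_betw b \<P> {B \<in> \<B>. x \<in> B}"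
  proof (rule bij_betw_imageI)
    show "inj_on b \<P>"
    proof (rule inj_onI)
      fix C D assume CD: "C \<in> \<P>" "D \<in> \<P>" "b C = b D"
      then have "b C \<in> C \<inter> D" using b(1) by (metis IntI)
      then show "C = D"
        using disjointD[OF partition_onD2[OF part]] CD(1,2) by blast
    qed
    show "b ` \<P> = {B \<in> \<B>. x \<in> B}"
    proof
      show "b ` \<P> \<subseteq> {B \<in> \<B>. x \<in> B}"
        using b partition_onD1[OF part] by blast
      show "{B \<in> \<B>. x \<in> B} \<subseteq> b ` \<P>"
      proof
        fix B assume B: "B \<in> {B \<in> \<B>. x \<in> B}"
        then obtain C where "C \<in> \<P>" "B \<in> C" using partition_onD1[OF part] by blast
        then have "b C = B" using uniq b B by blast
        then show "B \<in> b ` \<P>" using \<open>C \<in> \<P>\<close> by blast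
      qed
    qed
  qed
  then show ?thesis by (simp add: bij_betw_same_card)
qed

lemma configuration_imp_representatives:
  assumes "configuration v k V \<B>" and "0 < k"
  shows "\<exists>h. bij_betw h \<B> V \<and> (\<forall>B\<in>\<B>. h B \<in> B)"
proof -
  have fin: "finite V" and card: "card \<B> = card V"
    and blocks: "\<And>B. B \<in> \<B> \<Longrightarrow> B \<subseteq> V \<and> card B = k"
    and degree: "\<And>x. x \<in> V \<Longrightarrow> card {B \<in> \<B>. x \<in> B} = k"
    using assms by (auto simp: configuration_def blocks_of_size_def)
  have fin_block: "finite B" if "B \<in> \<B>" for B
    using blocks[OF that] fin by (auto intro: finite_subset)
  have finB: "finite \<B>"
    using fin blocks by (auto intro: finite_subset[of _ "Pow V"])
  have "\<exists>h. inj_on h \<B> \<and> (\<forall>B\<in>\<B>. h B \<in> B)"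
  proof (rule hall_distinct_representatives[OF finB, where A = "\<lambda>B. B"])
    show "finite B" if "B \<in> \<B>" for B using that by (rule fin_block)
    show "card S \<le> card (\<Union>((\<lambda>B. B) ` S))" if S: "S \<subseteq> \<B>" for S
      unfolding image_ident
    proof (rule card_le_card_Union_if_degree_le[OF _ \<open>0 < k\<close>])
      show "finite S" using S finB by (rule finite_subset)
      show "finite B \<and> k \<le> card B" if "B \<in> S" for B
        using that S blocks fin_block by auto
      show "card {B \<in> S. x \<in> B} \<le> k" if "x \<in> \<Union>S" for x
      proof -
        have "card {B \<in> S. x \<in> B} \<le> card {B \<in> \<B>. x \<in> B}"
          using S finB by (intro card_mono) auto
        moreover have "x \<in> V" using that S blocks by blast
        ultimately show ?thesis using degree by simp
      qed
    qed
  qed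
  then obtain h where h: "inj_on h \<B>" "\<forall>B\<in>\<B>. h B \<in> B" by blast
  have "h ` \<B> = V"
  proof (rule card_subset_eq[OF fin])
    show "h ` \<B> \<subseteq> V" using h blocks by blast
    show "card (h ` \<B>) = card V" using card_image[OF h(1)] card by simp
  qed
  then show ?thesis using h by (auto simp: bij_betw_def)
qed

theorem theorem5p1:
  fixes k v :: nat and V :: "'a set" and \<B> :: "'a set set"
  assumes "0 < k" and "0 < v" and "k dvd v"
    and "finite V" and "card V = v"
    and "\<forall>B\<in>\<B>. B \<subseteq> V \<and> card B = k"
  shows "PDP k v V \<B> \<longleftrightarrow> resolvable_configuration v k V \<B>"
proof
  assume pdp: "PDP k v V \<B>"
  then obtain \<P> where part: "partition_on \<B> \<P>" and "card \<P> = k"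
    and pclass: "\<And>C. C \<in> \<P> \<Longrightarrow> card C = v div k \<and> disjoint C"
    by (auto simp: PDP_def)
  have parallel: "partition_on V C" if "C \<in> \<P>" for C
  proof (rule disjoint_blocks_partition[OF \<open>finite V\<close> \<open>0 < k\<close>])
    show "B \<subseteq> V \<and> card B = k" if "B \<in> C" for B
      using that \<open>C \<in> \<P>\<close> partition_onD1[OF part] assms(6) by blast
  qed (use assms pclass that in auto)
  have "card {B \<in> \<B>. x \<in> B} = k" if "x \<in> V" for x
    using card_blocks_through_point[OF part parallel that] \<open>card \<P> = k\<close> by simp
  moreover have "card \<B> = v"
    using pdp by (auto simp: PDP_def dest: bij_betw_same_card)
  ultimately have "configuration v k V \<B>"
    using pdp by (auto simp: PDP_def configuration_def)
  then show "resolvable_configuration v k V \<B>"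
    using part \<open>card \<P> = k\<close> pclass parallel \<open>k dvd v\<close>
    unfolding resolvable_configuration_def by blast
next
  assume res: "resolvable_configuration v k V \<B>"
  then have conf: "configuration v k V \<B>" by (simp add: resolvable_configuration_def)
  obtain \<P> where "partition_on \<B> \<P>" and "card \<P> = k"
    and "\<forall>C\<in>\<P>. card C = v div k \<and> partition_on V C"
    using res by (auto simp: resolvable_configuration_def)
  then have "\<exists>\<P>. partition_on \<B> \<P> \<and> card \<P> = k \<and> (\<forall>C\<in>\<P>. card C = v div k \<and> disjoint C)"
    using partition_onD2 by blast
  then show "PDP k v V \<B>"
    using conf \<open>k dvd v\<close> configuration_imp_representatives[OF conf \<open>0 < k\<close>]
    by (simp add: PDP_def configuration_def)
qed

end
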